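(* Let $p\ge 2$ be an integer and let $\sigma(x,y,z)$ and $\pi(x,y,z)$ be $L_p^{min}$-formulas that are approximations to the sum and product. Then for every positive $L_p$-formula $\phi$, the precise interpretation $[\phi]$ is equal to or below the coarse interpretation of $\phi$ based on $\sigma$ and $\pi$ in the Lindenbaum algebra $L_p/Z$, i.e. $[\phi]\le\phi^{\mathfrak{C}_{\sigma,\pi}}$.
   Context: Languages. Fix an integer $p\ge 2$ (not necessarily prime). $L_p^{min}$ is the first-order language with a numeral for each natural number, a unary function symbol $-$, unary relation symbols $R_0,\dots,R_{p-1}$, and binary relation symbols $<$ and $=$. $L_p$ is $L_p^{min}$ expanded with binary function symbols $+$ and $\cdot$. The standard interpretation has domain $\mathbb{Z}$, with numerals, $-$, $<$, $=$, $+$, $\cdot$ having their usual meaning and $R_a$ denoting $\{n\in\mathbb{Z} : n\equiv a \pmod p\}$. The symbols $\le,>,\ge$ are abbreviations derived from $<$ and $=$. A formula is positive if its only connectives and quantifiers are among $\vee,\wedge,\forall,\exists$. Lindenbaum algebra. $Z$ is the set of $L_p$-formulas true in the standard interpretation under every assignment of integers to the variables. $L_p/Z$ is the set of equivalence classes $[\phi]$ of $L_p$-formulas, where $[\phi]=[\psi]$ iff $\phi\leftrightarrow\psi\in Z$, with order $[\phi]\le[\psi]$ iff $(\phi\rightarrow\psi)\in Z$ and with operations $\vee,\wedge,\neg,\exists x,\forall x$ induced by those on formulas. Equivalently, $[\phi]$ may be identified with the set of assignments of integers to variables satisfying $\phi$, with $\le$ being inclusion. The precise interpretation of $\phi\in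 L_p$ is $[\phi]$. Approximations. $L_p^{min}$-formulas $\sigma(x,y,z)$, $\pi(x,y,z)$ with three free variables are approximations to the sum and product if $[x+y=z]\le[\sigma(x,y,z)]$ and $[x\cdot y=z]\le[\pi(x,y,z)]$ in $L_p/Z$. Coarse interpretation. Given approximations $\sigma,\pi$ to the sum and product, $\mathfrak{C}=\mathfrak{C}_{\sigma,\pi}$ assigns to formulas elements of $L_p/Z$ as follows (with $x,y,z$ arbitrary variables and $u$ a fresh variable): - $\phi^{\mathfrak{C}}=[\phi]$ for $\phi\in L_p^{min}$; - $(x+y=z)^{\mathfrak{C}}=\left[\bigvee_{0\le a<p}\bigvee_{0\le b<p}\left(R_a(x)\wedge R_b(y)\wedge R_{a+b \bmod p}(z)\right)\right]\wedge[\sigma(x,y,z)]$; - $(x+y<z)^{\mathfrak{C}}=\exists u\left((x+y=u)^{\mathfrak{C}}\wedge[u<z]\right)$; - $(x\cdot y=z)^{\mathfrak{C}}=\left[\bigvee_{0\le a<p}\bigvee_{0\le b<p}\left(R_a(x)\wedge R_b(y)\wedge R_{a\cdot b \bmod p}(z)\right)\right]\wedge[\pi(x,y,z)]$; - $(x\cdot y<z)^{\mathfrak{C}}=\exists u\left((x\cdot y=u)^{\mathfrak{C}}\wedge[u<z]\right)$; - $\mathfrak{C}$ commutes with $\vee,\wedge,\neg,\exists x,\forall x$, e.g. $(\phi\vee\psi)^{\mathfrak{C}}=\phi^{\mathfrak{C}}\vee\psi^{\mathfrak{C}}$ and $(\exists x\,\phi)^{\mathfrak{C}}=\exists x\,(\phi^{\mathfrak{C}})$.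 This defines $\phi^{\mathfrak{C}}$ for all formulas built by connectives and quantifiers from atomic $L_p^{min}$-formulas and the four atomic forms $x+y=z$, $x+y<z$, $x\cdot y=z$, $x\cdot y<z$. An arbitrary $L_p$-formula is interpreted by first applying a fixed algorithmic translation into a formula of this kind that is equivalent to it over the standard integers; the translation takes positive formulas to positive formulas and leaves formulas already of this kind unchanged. *)

theory Defs
  imports Main "HOL-Number_Theory.Cong"
begin

text \<open>Variables are natural numbers. The relation symbols of \<open>L\<^sub>p\<close> depend on \<open>p\<close>, so the
  types below allow every index in \<open>Rel a t\<close>; the sets \<open>Lp p\<close> and \<open>Lmin p\<close> impose \<open>a < p\<close>.\<close>

datatype tm = Var nat | Num nat | Uminus tm | Plus tm tm | Times tm tm

datatype fm =
    Rel nat tm | Less tm tm | Eq tm tm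
  | Or fm fm | And fm fm | Neg fm | Exi nat fm | Uni nat fm

abbreviation Imp :: "fm \<Rightarrow> fm \<Rightarrow> fm" where
  "Imp \<phi> \<psi> \<equiv> Or (Neg \<phi>) \<psi>"

abbreviation Iff :: "fm \<Rightarrow> fm \<Rightarrow> fm" where
  "Iff \<phi> \<psi> \<equiv> And (Imp \<phi> \<psi>) (Imp \<psi> \<phi>)"

primrec rel_indices :: "fm \<Rightarrow> nat set" where
  "rel_indices (Rel a t) = {a}"
| "rel_indices (Less s t) = {}"
| "rel_indices (Eq s t) = {}"
| "rel_indices (Or \<phi> \<psi>) = rel_indices \<phi> \<union> rel_indices \<psi>"
| "rel_indices (And \<phi> \<psi>) = rel_indices \<phi> \<union> rel_indices \<psi>"
| "rel_indices (Neg \<phi>) = rel_indices \<phi>"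
| "rel_indices (Exi x \<phi>) = rel_indices \<phi>"
| "rel_indices (Uni x \<phi>) = rel_indices \<phi>"

primrec min_tm :: "tm \<Rightarrow> bool" where
  "min_tm (Var x) = True"
| "min_tm (Num n) = True"
| "min_tm (Uminus t) = min_tm t"
| "min_tm (Plus s t) = False"
| "min_tm (Times s t) = False"

primrec min_fm :: "fm \<Rightarrow> bool" where
  "min_fm (Rel a t) = min_tm t"
| "min_fm (Less s t) = (min_tm s \<and> min_tm t)"
| "min_fm (Eq s t) = (min_tm s \<and> min_tm t)"
| "min_fm (Or \<phi> \<psi>) = (min_fm \<phi> \<and> min_fm \<psi>)"
| "min_fm (And \<phi> \<psi>) = (min_fm \<phi> \<and> min_fm \<psi>)"
| "min_fm (Neg \<phi>) = min_fm \<phi>"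
| "min_fm (Exi x \<phi>) = min_fm \<phi>"
| "min_fm (Uni x \<phi>) = min_fm \<phi>"

definition Lp :: "nat \<Rightarrow> fm set" where
  "Lp p = {\<phi>. rel_indices \<phi> \<subseteq> {..<p}}"

definition Lmin :: "nat \<Rightarrow> fm set" where
  "Lmin p = {\<phi> \<in> Lp p. min_fm \<phi>}"

primrec positive :: "fm \<Rightarrow> bool" where
  "positive (Rel a t) = True"
| "positive (Less s t) = True"
| "positive (Eq s t) = True"
| "positive (Or \<phi> \<psi>) = (positive \<phi> \<and> positive \<psi>)"
| "positive (And \<phi> \<psi>) = (positive \<phi> \<and> positive \<psi>)"
| "positive (Neg \<phi>) = False"
| "positive (Exi x \<phi>) = positive \<phi>"
| "positive (Uni x \<phi>) = positive \<phi>"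

primrec fv_tm :: "tm \<Rightarrow> nat set" where
  "fv_tm (Var x) = {x}"
| "fv_tm (Num n) = {}"
| "fv_tm (Uminus t) = fv_tm t"
| "fv_tm (Plus s t) = fv_tm s \<union> fv_tm t"
| "fv_tm (Times s t) = fv_tm s \<union> fv_tm t"

primrec fv :: "fm \<Rightarrow> nat set" where
  "fv (Rel a t) = fv_tm t"
| "fv (Less s t) = fv_tm s \<union> fv_tm t"
| "fv (Eq s t) = fv_tm s \<union> fv_tm t"
| "fv (Or \<phi> \<psi>) = fv \<phi> \<union> fv \<psi>"
| "fv (And \<phi> \<psi>) = fv \<phi> \<union> fv \<psi>"
| "fv (Neg \<phi>) = fv \<phi>"
| "fv (Exi x \<phi>) = fv \<phi> - {x}"
| "fv (Uni x \<phi>) = fv \<phi> - {x}"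

text \<open>Simultaneous replacement of the free variables \<open>v\<close> by \<open>f v\<close>. A bound variable is renamed
  exactly when it would capture one of the new free variables.\<close>

definition avoid :: "nat \<Rightarrow> nat set \<Rightarrow> nat" where
  "avoid x A = (if x \<in> A then LEAST y. y \<notin> A else x)"

primrec rename_tm :: "(nat \<Rightarrow> nat) \<Rightarrow> tm \<Rightarrow> tm" where
  "rename_tm f (Var x) = Var (f x)"
| "rename_tm f (Num n) = Num n"
| "rename_tm f (Uminus t) = Uminus (rename_tm f t)"
| "rename_tm f (Plus s t) = Plus (rename_tm f s) (rename_tm f t)"
| "rename_tm f (Times s t) = Times (rename_tm f s) (rename_tm f t)"

primrec rename :: "(nat \<Rightarrow> nat) \<Rightarrow> fm \<Rightarrow> fm" where
  "rename f (Rel a t) = Rel a (rename_tm f t)"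
| "rename f (Less s t) = Less (rename_tm f s) (rename_tm f t)"
| "rename f (Eq s t) = Eq (rename_tm f s) (rename_tm f t)"
| "rename f (Or \<phi> \<psi>) = Or (rename f \<phi>) (rename f \<psi>)"
| "rename f (And \<phi> \<psi>) = And (rename f \<phi>) (rename f \<psi>)"
| "rename f (Neg \<phi>) = Neg (rename f \<phi>)"
| "rename f (Exi x \<phi>) =
     (let y = avoid x (f ` (fv \<phi> - {x})) in Exi y (rename (f(x := y)) \<phi>))"
| "rename f (Uni x \<phi>) =
     (let y = avoid x (f ` (fv \<phi> - {x})) in Uni y (rename (f(x := y)) \<phi>))"

text \<open>The parameters \<open>x, y, z\<close> of a formula \<open>\<sigma>(x, y, z)\<close> are the variables 0, 1, 2, in this order,
  and \<open>inst3 \<sigma> x y z\<close> is its instance at arbitrary variables.\<close>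

definition inst3 :: "fm \<Rightarrow> nat \<Rightarrow> nat \<Rightarrow> nat \<Rightarrow> fm" where
  "inst3 \<sigma> x y z = rename (id(0 := x, 1 := y, 2 := z)) \<sigma>"

primrec eval_tm :: "(nat \<Rightarrow> int) \<Rightarrow> tm \<Rightarrow> int" where
  "eval_tm e (Var x) = e x"
| "eval_tm e (Num n) = int n"
| "eval_tm e (Uminus t) = - eval_tm e t"
| "eval_tm e (Plus s t) = eval_tm e s + eval_tm e t"
| "eval_tm e (Times s t) = eval_tm e s * eval_tm e t"

primrec sat :: "nat \<Rightarrow> (nat \<Rightarrow> int) \<Rightarrow> fm \<Rightarrow> bool" where
  "sat p e (Rel a t) = [eval_tm e t = int a] (mod int p)"
| "sat p e (Less s t) = (eval_tm e s < eval_tm e t)"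
| "sat p e (Eq s t) = (eval_tm e s = eval_tm e t)"
| "sat p e (Or \<phi> \<psi>) = (sat p e \<phi> \<or> sat p e \<psi>)"
| "sat p e (And \<phi> \<psi>) = (sat p e \<phi> \<and> sat p e \<psi>)"
| "sat p e (Neg \<phi>) = (\<not> sat p e \<phi>)"
| "sat p e (Exi x \<phi>) = (\<exists>n. sat p (e(x := n)) \<phi>)"
| "sat p e (Uni x \<phi>) = (\<forall>n. sat p (e(x := n)) \<phi>)"

text \<open>The order and the operations on classes are induced by representatives; the lemmas
  \<open>lle_lclass\<close> to \<open>luni_lclass\<close> below show that the choice of representatives is irrelevant.\<close>

definition Z :: "nat \<Rightarrow> fm set" where
  "Z p = {\<phi> \<in> Lp p. \<forall>e. sat p e \<phi>}"

definition lind_rel :: "nat \<Rightarrow> (fm \<times> fm) set" where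
  "lind_rel p = {(\<phi>, \<psi>). \<phi> \<in> Lp p \<and> \<psi> \<in> Lp p \<and> Iff \<phi> \<psi> \<in> Z p}"

definition lindenbaum :: "nat \<Rightarrow> fm set set" where
  "lindenbaum p = Lp p // lind_rel p"

definition lclass :: "nat \<Rightarrow> fm \<Rightarrow> fm set" where
  "lclass p \<phi> = lind_rel p `` {\<phi>}"

definition lle :: "nat \<Rightarrow> fm set \<Rightarrow> fm set \<Rightarrow> bool" where
  "lle p X Y \<longleftrightarrow> (\<exists>\<phi>\<in>X. \<exists>\<psi>\<in>Y. Imp \<phi> \<psi> \<in> Z p)"

definition lor :: "nat \<Rightarrow> fm set \<Rightarrow> fm set \<Rightarrow> fm set" where
  "lor p X Y = (\<Union>\<phi>\<in>X. \<Union>\<psi>\<in>Y. lclass p (Or \<phi> \<psi>))"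

definition land :: "nat \<Rightarrow> fm set \<Rightarrow> fm set \<Rightarrow> fm set" where
  "land p X Y = (\<Union>\<phi>\<in>X. \<Union>\<psi>\<in>Y. lclass p (And \<phi> \<psi>))"

definition lneg :: "nat \<Rightarrow> fm set \<Rightarrow> fm set" where
  "lneg p X = (\<Union>\<phi>\<in>X. lclass p (Neg \<phi>))"

definition lexi :: "nat \<Rightarrow> nat \<Rightarrow> fm set \<Rightarrow> fm set" where
  "lexi p x X = (\<Union>\<phi>\<in>X. lclass p (Exi x \<phi>))"

definition luni :: "nat \<Rightarrow> nat \<Rightarrow> fm set \<Rightarrow> fm set" where
  "luni p x X = (\<Union>\<phi>\<in>X. lclass p (Uni x \<phi>))"

definition approx_sum :: "nat \<Rightarrow> fm \<Rightarrow> bool" where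
  "approx_sum p \<sigma> \<longleftrightarrow> \<sigma> \<in> Lmin p \<and> fv \<sigma> \<subseteq> {0, 1, 2} \<and>
     lle p (lclass p (Eq (Plus (Var 0) (Var 1)) (Var 2))) (lclass p \<sigma>)"

definition approx_prod :: "nat \<Rightarrow> fm \<Rightarrow> bool" where
  "approx_prod p \<pi> \<longleftrightarrow> \<pi> \<in> Lmin p \<and> fv \<pi> \<subseteq> {0, 1, 2} \<and>
     lle p (lclass p (Eq (Times (Var 0) (Var 1)) (Var 2))) (lclass p \<pi>)"

text \<open>The empty disjunction, which does not occur below when \<open>p > 0\<close>, is a false atom.\<close>

fun big_or :: "fm list \<Rightarrow> fm" where
  "big_or [] = Less (Num 0) (Num 0)"
| "big_or [\<phi>] = \<phi>"
| "big_or (\<phi> # \<psi> # \<phi>s) = Or \<phi> (big_or (\<psi> # \<phi>s))"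

definition residue_fm :: "nat \<Rightarrow> (nat \<Rightarrow> nat \<Rightarrow> nat) \<Rightarrow> nat \<Rightarrow> nat \<Rightarrow> nat \<Rightarrow> fm" where
  "residue_fm p f x y z =
     big_or (map (\<lambda>a. big_or (map (\<lambda>b.
       And (And (Rel a (Var x)) (Rel b (Var y))) (Rel (f a b mod p) (Var z))) [0..<p])) [0..<p])"

definition coarse_sum :: "nat \<Rightarrow> fm \<Rightarrow> nat \<Rightarrow> nat \<Rightarrow> nat \<Rightarrow> fm set" where
  "coarse_sum p \<sigma> x y z =
     land p (lclass p (residue_fm p (+) x y z)) (lclass p (inst3 \<sigma> x y z))"

definition coarse_prod :: "nat \<Rightarrow> fm \<Rightarrow> nat \<Rightarrow> nat \<Rightarrow> nat \<Rightarrow> fm set" where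
  "coarse_prod p \<pi> x y z =
     land p (lclass p (residue_fm p (*) x y z)) (lclass p (inst3 \<pi> x y z))"

definition fresh3 :: "nat \<Rightarrow> nat \<Rightarrow> nat \<Rightarrow> nat" where
  "fresh3 x y z = Suc (Max {x, y, z})"

text \<open>The formulas built by connectives and quantifiers from atomic \<open>L\<^sub>p\<^sup>m\<^sup>i\<^sup>n\<close>-formulas and the
  four atomic forms with a sum or product of two variables.\<close>

inductive basic :: "nat \<Rightarrow> fm \<Rightarrow> bool" for p :: nat where
  "a < p \<Longrightarrow> min_tm t \<Longrightarrow> basic p (Rel a t)"
| "min_tm s \<Longrightarrow> min_tm t \<Longrightarrow> basic p (Less s t)"
| "min_tm s \<Longrightarrow> min_tm t \<Longrightarrow> basic p (Eq s t)"
| "basic p (Eq (Plus (Var x) (Var y)) (Var z))"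
| "basic p (Less (Plus (Var x) (Var y)) (Var z))"
| "basic p (Eq (Times (Var x) (Var y)) (Var z))"
| "basic p (Less (Times (Var x) (Var y)) (Var z))"
| "basic p \<phi> \<Longrightarrow> basic p \<psi> \<Longrightarrow> basic p (Or \<phi> \<psi>)"
| "basic p \<phi> \<Longrightarrow> basic p \<psi> \<Longrightarrow> basic p (And \<phi> \<psi>)"
| "basic p \<phi> \<Longrightarrow> basic p (Neg \<phi>)"
| "basic p \<phi> \<Longrightarrow> basic p (Exi x \<phi>)"
| "basic p \<phi> \<Longrightarrow> basic p (Uni x \<phi>)"

text \<open>The coarse interpretation of basic formulas. It is unspecified on the remaining atoms. The
  clause for \<open>L\<^sub>p\<^sup>m\<^sup>i\<^sup>n\<close> is only stated for atoms; \<open>coarse_Lmin\<close> below extends it to all formulas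
  of that language.\<close>

primrec coarse :: "nat \<Rightarrow> fm \<Rightarrow> fm \<Rightarrow> fm \<Rightarrow> fm set" where
  "coarse p \<sigma> \<pi> (Rel a t) = (if min_tm t then lclass p (Rel a t) else undefined)"
| "coarse p \<sigma> \<pi> (Less s t) =
     (if min_tm s \<and> min_tm t then lclass p (Less s t)
      else case (s, t) of
        (Plus (Var x) (Var y), Var z) \<Rightarrow>
          (let u = fresh3 x y z in
           lexi p u (land p (coarse_sum p \<sigma> x y u) (lclass p (Less (Var u) (Var z)))))
      | (Times (Var x) (Var y), Var z) \<Rightarrow>
          (let u = fresh3 x y z in
           lexi p u (land p (coarse_prod p \<pi> x y u) (lclass p (Less (Var u) (Var z)))))
      | _ \<Rightarrow> undefined)"
| "coarse p \<sigma> \<pi> (Eq s t) =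
     (if min_tm s \<and> min_tm t then lclass p (Eq s t)
      else case (s, t) of
        (Plus (Var x) (Var y), Var z) \<Rightarrow> coarse_sum p \<sigma> x y z
      | (Times (Var x) (Var y), Var z) \<Rightarrow> coarse_prod p \<pi> x y z
      | _ \<Rightarrow> undefined)"
| "coarse p \<sigma> \<pi> (Or \<phi> \<psi>) = lor p (coarse p \<sigma> \<pi> \<phi>) (coarse p \<sigma> \<pi> \<psi>)"
| "coarse p \<sigma> \<pi> (And \<phi> \<psi>) = land p (coarse p \<sigma> \<pi> \<phi>) (coarse p \<sigma> \<pi> \<psi>)"
| "coarse p \<sigma> \<pi> (Neg \<phi>) = lneg p (coarse p \<sigma> \<pi> \<phi>)"
| "coarse p \<sigma> \<pi> (Exi x \<phi>) = lexi p x (coarse p \<sigma> \<pi> \<phi>)"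
| "coarse p \<sigma> \<pi> (Uni x \<phi>) = luni p x (coarse p \<sigma> \<pi> \<phi>)"

text \<open>The properties required of the translation of arbitrary \<open>L\<^sub>p\<close>-formulas into basic ones.
  Nothing else about \<open>T\<close>, such as
  its computability, is assumed.\<close>

definition translation :: "nat \<Rightarrow> (fm \<Rightarrow> fm) \<Rightarrow> bool" where
  "translation p T \<longleftrightarrow> (\<forall>\<phi>\<in>Lp p.
     basic p (T \<phi>) \<and> Iff \<phi> (T \<phi>) \<in> Z p \<and>
     (positive \<phi> \<longrightarrow> positive (T \<phi>)) \<and> (basic p \<phi> \<longrightarrow> T \<phi> = \<phi>))"

definition coarse_interp :: "nat \<Rightarrow> fm \<Rightarrow> fm \<Rightarrow> (fm \<Rightarrow> fm) \<Rightarrow> fm \<Rightarrow> fm set" where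
  "coarse_interp p \<sigma> \<pi> T \<phi> = coarse p \<sigma> \<pi> (T \<phi>)"

lemma lind_rel_iff:
  "(\<phi>, \<psi>) \<in> lind_rel p \<longleftrightarrow>
     \<phi> \<in> Lp p \<and> \<psi> \<in> Lp p \<and> (\<forall>e. sat p e \<phi> = sat p e \<psi>)"
  unfolding lind_rel_def Z_def Lp_def by (simp, blast)

lemma equiv_lind_rel: "equiv (Lp p) (lind_rel p)"
proof (rule equivI)
  show "lind_rel p \<subseteq> Lp p \<times> Lp p" by (auto simp: lind_rel_iff)
  show "refl_on (Lp p) (lind_rel p)" by (rule refl_onI) (simp add: lind_rel_iff)
  show "sym (lind_rel p)" by (rule symI) (simp add: lind_rel_iff)
  show "trans (lind_rel p)" by (rule transI) (simp add: lind_rel_iff)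
qed

lemma mem_lclass_iff:
  "\<psi> \<in> lclass p \<phi> \<longleftrightarrow> \<phi> \<in> Lp p \<and> \<psi> \<in> Lp p \<and> (\<forall>e. sat p e \<phi> = sat p e \<psi>)"
  by (simp add: lclass_def lind_rel_iff)

lemma lclass_in_lindenbaum: "\<phi> \<in> Lp p \<Longrightarrow> lclass p \<phi> \<in> lindenbaum p"
  by (simp add: lclass_def lindenbaum_def quotientI)

lemma lclass_self: "\<phi> \<in> Lp p \<Longrightarrow> \<phi> \<in> lclass p \<phi>"
  by (simp add: mem_lclass_iff)

lemma lle_lclass:
  assumes "\<phi> \<in> Lp p" "\<psi> \<in> Lp p"
  shows "lle p (lclass p \<phi>) (lclass p \<psi>) \<longleftrightarrow> Imp \<phi> \<psi> \<in> Z p"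
proof -
  have "Imp \<phi>' \<psi>' \<in> Z p \<longleftrightarrow> Imp \<phi> \<psi> \<in> Z p"
    if "\<phi>' \<in> lclass p \<phi>" "\<psi>' \<in> lclass p \<psi>" for \<phi>' \<psi>'
    using that by (simp add: mem_lclass_iff Z_def Lp_def)
  with assms[THEN lclass_self] show ?thesis unfolding lle_def by blast
qed

lemma lor_lclass:
  assumes "\<phi> \<in> Lp p" "\<psi> \<in> Lp p"
  shows "lor p (lclass p \<phi>) (lclass p \<psi>) = lclass p (Or \<phi> \<psi>)"
proof -
  have "lclass p (Or \<phi>' \<psi>') = lclass p (Or \<phi> \<psi>)"
    if "\<phi>' \<in> lclass p \<phi>" "\<psi>' \<in> lclass p \<psi>" for \<phi>' \<psi>'
    using that by (intro set_eqI) (simp add: mem_lclass_iff Lp_def)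
  with assms[THEN lclass_self] show ?thesis unfolding lor_def by blast
qed

lemma land_lclass:
  assumes "\<phi> \<in> Lp p" "\<psi> \<in> Lp p"
  shows "land p (lclass p \<phi>) (lclass p \<psi>) = lclass p (And \<phi> \<psi>)"
proof -
  have "lclass p (And \<phi>' \<psi>') = lclass p (And \<phi> \<psi>)"
    if "\<phi>' \<in> lclass p \<phi>" "\<psi>' \<in> lclass p \<psi>" for \<phi>' \<psi>'
    using that by (intro set_eqI) (simp add: mem_lclass_iff Lp_def)
  with assms[THEN lclass_self] show ?thesis unfolding land_def by blast
qed

lemma lneg_lclass:
  assumes "\<phi> \<in> Lp p"
  shows "lneg p (lclass p \<phi>) = lclass p (Neg \<phi>)"
proof -
  have "lclass p (Neg \<phi>') = lclass p (Neg \<phi>)" if "\<phi>' \<in> lclass p \<phi>" for \<phi>'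
    using that by (intro set_eqI) (simp add: mem_lclass_iff Lp_def)
  with assms[THEN lclass_self] show ?thesis unfolding lneg_def by blast
qed

lemma lexi_lclass:
  assumes "\<phi> \<in> Lp p"
  shows "lexi p x (lclass p \<phi>) = lclass p (Exi x \<phi>)"
proof -
  have "lclass p (Exi x \<phi>') = lclass p (Exi x \<phi>)" if "\<phi>' \<in> lclass p \<phi>" for \<phi>'
    using that by (intro set_eqI) (simp add: mem_lclass_iff Lp_def)
  with assms[THEN lclass_self] show ?thesis unfolding lexi_def by blast
qed

lemma luni_lclass:
  assumes "\<phi> \<in> Lp p"
  shows "luni p x (lclass p \<phi>) = lclass p (Uni x \<phi>)"
proof -
  have "lclass p (Uni x \<phi>') = lclass p (Uni x \<phi>)" if "\<phi>' \<in> lclass p \<phi>" for \<phi>'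
    using that by (intro set_eqI) (simp add: mem_lclass_iff Lp_def)
  with assms[THEN lclass_self] show ?thesis unfolding luni_def by blast
qed

lemma coarse_Lmin:
  assumes "\<phi> \<in> Lmin p"
  shows "coarse p \<sigma> \<pi> \<phi> = lclass p \<phi>"
  using assms
proof (induction \<phi>)
  case (Or \<phi> \<psi>)
  then show ?case by (simp add: Lmin_def Lp_def lor_lclass)
next
  case (And \<phi> \<psi>)
  then show ?case by (simp add: Lmin_def Lp_def land_lclass)
qed (auto simp: Lmin_def Lp_def lneg_lclass lexi_lclass luni_lclass)

text \<open>The predicate \<open>translation p\<close> is satisfiable (\<open>translation_flatten\<close> below): terms are
  flattened by naming their subterms with fresh variables. If all variables of \<open>t\<close> and \<open>z\<close> are below \<open>n\<close>, then \<open>graph t z n\<close>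
  expresses \<open>t = z\<close>.\<close>

primrec graph :: "tm \<Rightarrow> nat \<Rightarrow> nat \<Rightarrow> fm" where
  "graph (Var x) z n = Eq (Var x) (Var z)"
| "graph (Num k) z n = Eq (Num k) (Var z)"
| "graph (Uminus t) z n =
     Exi n (And (graph t n (Suc n)) (Eq (Uminus (Var n)) (Var z)))"
| "graph (Plus s t) z n =
     Exi n (Exi (Suc n) (And (And (graph s n (n + 2)) (graph t (Suc n) (n + 2)))
       (Eq (Plus (Var n) (Var (Suc n))) (Var z))))"
| "graph (Times s t) z n =
     Exi n (Exi (Suc n) (And (And (graph s n (n + 2)) (graph t (Suc n) (n + 2)))
       (Eq (Times (Var n) (Var (Suc n))) (Var z))))"

definition fresh_tm :: "tm \<Rightarrow> nat" where
  "fresh_tm t = Suc (Max (insert 0 (fv_tm t)))"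

primrec flatten :: "nat \<Rightarrow> fm \<Rightarrow> fm" where
  "flatten p (Rel a t) =
     (if basic p (Rel a t) then Rel a t
      else let n = fresh_tm t in Exi n (And (graph t n (Suc n)) (Rel a (Var n))))"
| "flatten p (Less s t) =
     (if basic p (Less s t) then Less s t
      else let n = max (fresh_tm s) (fresh_tm t) in
        Exi n (Exi (Suc n) (And (And (graph s n (n + 2)) (graph t (Suc n) (n + 2)))
          (Less (Var n) (Var (Suc n))))))"
| "flatten p (Eq s t) =
     (if basic p (Eq s t) then Eq s t
      else let n = max (fresh_tm s) (fresh_tm t) in
        Exi n (Exi (Suc n) (And (And (graph s n (n + 2)) (graph t (Suc n) (n + 2)))
          (Eq (Var n) (Var (Suc n))))))"
| "flatten p (Or \<phi> \<psi>) = Or (flatten p \<phi>) (flatten p \<psi>)"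
| "flatten p (And \<phi> \<psi>) = And (flatten p \<phi>) (flatten p \<psi>)"
| "flatten p (Neg \<phi>) = Neg (flatten p \<phi>)"
| "flatten p (Exi x \<phi>) = Exi x (flatten p \<phi>)"
| "flatten p (Uni x \<phi>) = Uni x (flatten p \<phi>)"

lemma eval_tm_cong: "(\<And>x. x \<in> fv_tm t \<Longrightarrow> e x = e' x) \<Longrightarrow> eval_tm e t = eval_tm e' t"
  by (induction t) auto

lemma eval_tm_upd: "n \<notin> fv_tm t \<Longrightarrow> eval_tm (e(n := k)) t = eval_tm e t"
  by (rule eval_tm_cong) auto

lemma sat_graph:
  "fv_tm t \<subseteq> {..<n} \<Longrightarrow> z < n \<Longrightarrow> sat p e (graph t z n) \<longleftrightarrow> eval_tm e t = e z"
proof (induction t arbitrary: z n e)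
  case (Uminus t)
  then have "fv_tm t \<subseteq> {..<Suc n}" "n \<notin> fv_tm t" by auto
  with Uminus show ?case by (simp add: eval_tm_upd fun_upd_same fun_upd_other del: fun_upd_apply)
next
  case (Plus s t)
  then have "fv_tm s \<subseteq> {..<n + 2}" "n \<notin> fv_tm s" "Suc n \<notin> fv_tm s"
    "fv_tm t \<subseteq> {..<n + 2}" "n \<notin> fv_tm t" "Suc n \<notin> fv_tm t" by auto
  with Plus show ?case by (simp add: eval_tm_upd fun_upd_same fun_upd_other del: fun_upd_apply)
next
  case (Times s t)
  then have "fv_tm s \<subseteq> {..<n + 2}" "n \<notin> fv_tm s" "Suc n \<notin> fv_tm s"
    "fv_tm t \<subseteq> {..<n + 2}" "n \<notin> fv_tm t" "Suc n \<notin> fv_tm t" by auto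
  with Times show ?case by (simp add: eval_tm_upd fun_upd_same fun_upd_other del: fun_upd_apply)
qed auto

lemma finite_fv_tm: "finite (fv_tm t)"
  by (induction t) auto

lemma fv_tm_less_fresh: "fv_tm t \<subseteq> {..<fresh_tm t}"
  using finite_fv_tm[of t] by (auto simp: fresh_tm_def less_Suc_eq_le)

lemma basic_graph: "basic p (graph t z n)"
  by (induction t arbitrary: z n) (auto intro!: basic.intros)

lemma positive_graph: "positive (graph t z n)"
  by (induction t arbitrary: z n) auto

lemma basic_imp_Lp: "basic p \<phi> \<Longrightarrow> \<phi> \<in> Lp p"
  by (induction rule: basic.induct) (auto simp: Lp_def)

lemma basic_flatten: "\<phi> \<in> Lp p \<Longrightarrow> basic p (flatten p \<phi>)"
  by (induction \<phi>) (auto simp: Let_def Lp_def intro!: basic.intros basic_graph)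

lemma positive_flatten: "positive \<phi> \<Longrightarrow> positive (flatten p \<phi>)"
  by (induction \<phi>) (auto simp: Let_def positive_graph)

lemma flatten_basic: "basic p \<phi> \<Longrightarrow> flatten p \<phi> = \<phi>"
  by (induction rule: basic.induct) (auto intro: basic.intros)

lemma sat_flatten: "sat p e (flatten p \<phi>) \<longleftrightarrow> sat p e \<phi>"
proof (induction \<phi> arbitrary: e)
  case (Rel a t)
  have "fv_tm t \<subseteq> {..<Suc (fresh_tm t)}" "fresh_tm t \<notin> fv_tm t"
    using fv_tm_less_fresh[of t] by auto
  then show ?case by (simp add: Let_def sat_graph eval_tm_upd fun_upd_same fun_upd_other del: fun_upd_apply)
next
  case (Less s t)
  define n where "n = max (fresh_tm s) (fresh_tm t)"
  have "fv_tm s \<subseteq> {..<n}" "fv_tm t \<subseteq> {..<n}"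
    using fv_tm_less_fresh[of s] fv_tm_less_fresh[of t] by (auto simp: n_def)
  then have "fv_tm s \<subseteq> {..<n + 2}" "n \<notin> fv_tm s" "Suc n \<notin> fv_tm s"
    "fv_tm t \<subseteq> {..<n + 2}" "n \<notin> fv_tm t" "Suc n \<notin> fv_tm t" by auto
  then show ?case by (simp add: Let_def sat_graph eval_tm_upd fun_upd_same fun_upd_other del: fun_upd_apply flip: n_def)
next
  case (Eq s t)
  define n where "n = max (fresh_tm s) (fresh_tm t)"
  have "fv_tm s \<subseteq> {..<n}" "fv_tm t \<subseteq> {..<n}"
    using fv_tm_less_fresh[of s] fv_tm_less_fresh[of t] by (auto simp: n_def)
  then have "fv_tm s \<subseteq> {..<n + 2}" "n \<notin> fv_tm s" "Suc n \<notin> fv_tm s"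
    "fv_tm t \<subseteq> {..<n + 2}" "n \<notin> fv_tm t" "Suc n \<notin> fv_tm t" by auto
  then show ?case by (simp add: Let_def sat_graph eval_tm_upd fun_upd_same fun_upd_other del: fun_upd_apply flip: n_def)
qed simp_all

lemma translation_flatten: "translation p (flatten p)"
proof -
  have "Iff \<phi> (flatten p \<phi>) \<in> Z p" if "\<phi> \<in> Lp p" for \<phi>
    using that basic_imp_Lp[OF basic_flatten[OF that]] by (auto simp: Z_def Lp_def sat_flatten)
  then show ?thesis
    by (simp add: translation_def basic_flatten positive_flatten flatten_basic)
qed

end

theory Submission
  imports Defs
begin

text \<open>Each atomic clause of the coarse interpretation weakens the precise one: \<open>\<sigma>\<close> and \<open>\<pi>\<close> contain
  the graphs of sum and product by hypothesis, and the residue condition holds because congruence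
  is compatible with both operations. All positive connectives and quantifiers are monotone.\<close>

section \<open>Semantics of variable renaming\<close>

lemma sat_cong: "(\<And>x. x \<in> fv \<phi> \<Longrightarrow> e x = e' x) \<Longrightarrow> sat p e \<phi> = sat p e' \<phi>"
proof (induction \<phi> arbitrary: e e')
  case (Rel a t)
  then have "eval_tm e t = eval_tm e' t" by (intro eval_tm_cong) auto
  then show ?case by simp
next
  case (Less s t)
  then have "eval_tm e s = eval_tm e' s" "eval_tm e t = eval_tm e' t"
    by (auto intro!: eval_tm_cong)
  then show ?case by simp
next
  case (Eq s t)
  then have "eval_tm e s = eval_tm e' s" "eval_tm e t = eval_tm e' t"
    by (auto intro!: eval_tm_cong)
  then show ?case by simp
next
  case (Or \<phi> \<psi>)
  have "sat p e \<phi> = sat p e' \<phi>" "sat p e \<psi> = sat p e' \<psi>"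
    by (rule Or.IH, simp add: Or.prems)+
  then show ?case by simp
next
  case (And \<phi> \<psi>)
  have "sat p e \<phi> = sat p e' \<phi>" "sat p e \<psi> = sat p e' \<psi>"
    by (rule And.IH, simp add: And.prems)+
  then show ?case by simp
next
  case (Neg \<phi>)
  have "sat p e \<phi> = sat p e' \<phi>"
    by (rule Neg.IH) (simp add: Neg.prems)
  then show ?case by simp
next
  case (Exi x \<phi>)
  have "sat p (e(x := n)) \<phi> = sat p (e'(x := n)) \<phi>" for n
    by (rule Exi.IH) (simp add: Exi.prems)
  then show ?case by simp
next
  case (Uni x \<phi>)
  have "sat p (e(x := n)) \<phi> = sat p (e'(x := n)) \<phi>" for n
    by (rule Uni.IH) (simp add: Uni.prems)
  then show ?case by simp
qed

lemma finite_fv: "finite (fv \<phi>)"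
  by (induction \<phi>) (auto simp: finite_fv_tm)

lemma avoid_notin:
  assumes "finite A"
  shows "avoid x A \<notin> A"
proof -
  obtain y where "y \<notin> A" using ex_new_if_finite[OF infinite_UNIV_nat assms] by blast
  then have "(LEAST y. y \<notin> A) \<notin> A" by (rule LeastI)
  then show ?thesis by (simp add: avoid_def)
qed

lemma eval_rename_tm: "eval_tm e (rename_tm f t) = eval_tm (e \<circ> f) t"
  by (induction t) auto

text \<open>The condition on \<open>y\<close> says that renaming the bound variable \<open>x\<close>
  to \<open>y\<close> captures nothing: a free variable of \<open>\<phi>\<close> other than
  \<open>x\<close> is sent to a variable different from \<open>y\<close>, so setting
  \<open>y\<close> to \<open>n\<close> is felt only at \<open>x\<close>.\<close>

lemma sat_upd_rename:
  assumes "y \<notin> f ` (fv \<phi> - {x})"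
  shows "sat p (e(y := n) \<circ> f(x := y)) \<phi> = sat p ((e \<circ> f)(x := n)) \<phi>"
  using assms by (intro sat_cong) auto

text \<open>Substitution lemma. The map \<open>f\<close> may identify variables: in the quantifier
  cases \<open>avoid\<close> chooses a bound variable outside the image of the remaining free ones.
  Hence \<open>inst3\<close> behaves as intended even at coinciding variables.\<close>

lemma sat_rename: "sat p e (rename f \<phi>) = sat p (e \<circ> f) \<phi>"
proof (induction \<phi> arbitrary: e f)
  case (Exi x \<phi>)
  have "avoid x (f ` (fv \<phi> - {x})) \<notin> f ` (fv \<phi> - {x})"
    by (rule avoid_notin) (simp add: finite_fv)
  from sat_upd_rename[OF this] show ?case by (simp add: Let_def Exi.IH o_def del: fun_upd_apply)
next
  case (Uni x \<phi>)
  have "avoid x (f ` (fv \<phi> - {x})) \<notin> f ` (fv \<phi> - {x})"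
    by (rule avoid_notin) (simp add: finite_fv)
  from sat_upd_rename[OF this] show ?case by (simp add: Let_def Uni.IH o_def del: fun_upd_apply)
qed (simp_all add: eval_rename_tm)

lemma rel_indices_rename: "rel_indices (rename f \<phi>) = rel_indices \<phi>"
  by (induction \<phi> arbitrary: f) (simp_all add: Let_def)

lemma inst3_Lp: "\<phi> \<in> Lp p \<Longrightarrow> inst3 \<phi> x y z \<in> Lp p"
  by (simp add: inst3_def Lp_def rel_indices_rename)

section \<open>The residue condition\<close>

lemma sat_big_or: "sat p e (big_or \<phi>s) \<longleftrightarrow> (\<exists>\<phi>\<in>set \<phi>s. sat p e \<phi>)"
  by (induction \<phi>s rule: big_or.induct) auto

lemma big_or_Lp: "set \<phi>s \<subseteq> Lp p \<Longrightarrow> big_or \<phi>s \<in> Lp p"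
  by (induction \<phi>s rule: big_or.induct) (auto simp: Lp_def)

lemma residue_fm_Lp: "residue_fm p f x y z \<in> Lp p"
  unfolding residue_fm_def
  by (rule big_or_Lp, clarsimp, rule big_or_Lp, auto simp: Lp_def)

lemma sat_residue_fm:
  assumes "p > 0"
    and "\<And>a b. [e x = int a] (mod int p) \<Longrightarrow> [e y = int b] (mod int p) \<Longrightarrow>
      [e z = int (f a b)] (mod int p)"
  shows "sat p e (residue_fm p f x y z)"
proof -
  \<comment> \<open>The disjunct that holds is the one at the least nonnegative residues of
    \<open>e x\<close> and \<open>e y\<close>.\<close>
  define a b where "a = nat (e x mod int p)" and "b = nat (e y mod int p)"
  have lt: "a < p" "b < p" using assms(1) by (simp_all add: a_def b_def nat_less_iff)
  have cong: "[e x = int a] (mod int p)" "[e y = int b] (mod int p)"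
    using assms(1) by (simp_all add: a_def b_def cong_def)
  have "[e z = int (f a b mod p)] (mod int p)"
    using assms(2)[OF cong] by (simp add: cong_def zmod_int)
  with lt cong have "\<exists>a\<in>{0..<p}. [e x = int a] (mod int p) \<and>
      (\<exists>b\<in>{0..<p}. [e y = int b] (mod int p) \<and> [e z = int (f a b mod p)] (mod int p))"
    by (meson atLeastLessThan_iff zero_le)
  then show ?thesis by (simp add: residue_fm_def sat_big_or)
qed

section \<open>Coarse interpretation of sums and products\<close>

text \<open>Exhibits one formula representing the class, so that comparisons in the algebra become
  statements about \<open>sat\<close>.\<close>

lemma coarse_sum_eq:
  assumes "\<sigma> \<in> Lp p"
  shows "coarse_sum p \<sigma> x y z = lclass p (And (residue_fm p (+) x y z) (inst3 \<sigma> x y z))"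
  by (simp add: coarse_sum_def land_lclass residue_fm_Lp inst3_Lp assms)

lemma coarse_prod_eq:
  assumes "\<pi> \<in> Lp p"
  shows "coarse_prod p \<pi> x y z = lclass p (And (residue_fm p (*) x y z) (inst3 \<pi> x y z))"
  by (simp add: coarse_prod_def land_lclass residue_fm_Lp inst3_Lp assms)

text \<open>The approximation hypothesis concerns the variables 0, 1, 2 but all assignments; the
  substitution lemma carries it over to arbitrary \<open>x\<close>, \<open>y\<close>,
  \<open>z\<close>.\<close>

lemma approx_sumD:
  assumes "approx_sum p \<sigma>"
  shows "\<sigma> \<in> Lp p" and "e x + e y = e z \<Longrightarrow> sat p e (inst3 \<sigma> x y z)"
proof -
  show L: "\<sigma> \<in> Lp p" using assms by (simp add: approx_sum_def Lmin_def)
  have "Imp (Eq (Plus (Var 0) (Var 1)) (Var 2)) \<sigma> \<in> Z p"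
    using assms L by (simp add: approx_sum_def Lp_def flip: lle_lclass)
  then have "e' 0 + e' 1 = e' 2 \<Longrightarrow> sat p e' \<sigma>" for e'
    by (simp add: Z_def)
  \<comment> \<open>Here \<open>e'\<close> is \<open>e\<close> composed with the renaming in
    \<open>inst3\<close>, which takes the values \<open>e x\<close>, \<open>e y\<close>,
    \<open>e z\<close> at 0, 1, 2.\<close>
  then show "e x + e y = e z \<Longrightarrow> sat p e (inst3 \<sigma> x y z)"
    by (simp add: inst3_def sat_rename)
qed

lemma approx_prodD:
  assumes "approx_prod p \<pi>"
  shows "\<pi> \<in> Lp p" and "e x * e y = e z \<Longrightarrow> sat p e (inst3 \<pi> x y z)"
proof -
  show L: "\<pi> \<in> Lp p" using assms by (simp add: approx_prod_def Lmin_def)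
  have "Imp (Eq (Times (Var 0) (Var 1)) (Var 2)) \<pi> \<in> Z p"
    using assms L by (simp add: approx_prod_def Lp_def flip: lle_lclass)
  then have "e' 0 * e' 1 = e' 2 \<Longrightarrow> sat p e' \<pi>" for e'
    by (simp add: Z_def)
  then show "e x * e y = e z \<Longrightarrow> sat p e (inst3 \<pi> x y z)"
    by (simp add: inst3_def sat_rename)
qed

lemma sat_coarse_sum:
  assumes "p > 0" "approx_sum p \<sigma>" "e x + e y = e z"
  shows "sat p e (And (residue_fm p (+) x y z) (inst3 \<sigma> x y z))"
proof -
  have "sat p e (residue_fm p (+) x y z)"
    \<comment> \<open>Replacing \<open>e z\<close> by \<open>e x + e y\<close> reduces the residue
      condition to compatibility of congruence with addition.\<close>
    by (rule sat_residue_fm) (use assms in \<open>simp_all add: cong_add flip: assms(3)\<close>)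
  with approx_sumD(2)[OF assms(2,3)] show ?thesis by simp
qed

lemma sat_coarse_prod:
  assumes "p > 0" "approx_prod p \<pi>" "e x * e y = e z"
  shows "sat p e (And (residue_fm p (*) x y z) (inst3 \<pi> x y z))"
proof -
  have "sat p e (residue_fm p (*) x y z)"
    by (rule sat_residue_fm) (use assms in \<open>simp_all add: cong_mult flip: assms(3)\<close>)
  with approx_prodD(2)[OF assms(2,3)] show ?thesis by simp
qed

section \<open>Induction on positive basic formulas\<close>

lemma fresh3_neq: "x \<noteq> fresh3 x y z" "y \<noteq> fresh3 x y z" "z \<noteq> fresh3 x y z"
  by (auto simp: fresh3_def max_def)

text \<open>The induction carries a representative \<open>\<psi>\<close> in \<open>Lp p\<close>,
  because the operations on classes are computed by representatives there. As \<open>\<psi>\<close>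
  is chosen before the assignment \<open>e\<close>, the induction hypothesis applies to the updated
  assignments in the quantifier cases.\<close>

lemma coarse_basic_weaker:
  assumes "basic p \<phi>" "positive \<phi>" "p > 0" "approx_sum p \<sigma>" "approx_prod p \<pi>"
  shows "\<exists>\<psi>\<in>Lp p. coarse p \<sigma> \<pi> \<phi> = lclass p \<psi> \<and> (\<forall>e. sat p e \<phi> \<longrightarrow> sat p e \<psi>)"
  using assms(1,2)
proof (induction rule: basic.induct)
  case (1 a t)
  then show ?case by (intro bexI[of _ "Rel a t"]) (auto simp: Lp_def)
next
  case (2 s t)
  then show ?case by (intro bexI[of _ "Less s t"]) (auto simp: Lp_def)
next
  case (3 s t)
  then show ?case by (intro bexI[of _ "Eq s t"]) (auto simp: Lp_def)
next
  case (4 x y z)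
  let ?\<psi> = "And (residue_fm p (+) x y z) (inst3 \<sigma> x y z)"
  have "?\<psi> \<in> Lp p"
    using residue_fm_Lp inst3_Lp[OF approx_sumD(1)[OF assms(4)]] by (simp add: Lp_def)
  then show ?case
    using sat_coarse_sum[OF assms(3,4)]
    by (intro bexI[of _ ?\<psi>]) (simp_all add: coarse_sum_eq approx_sumD(1)[OF assms(4)])
next
  case (5 x y z)
  define u where "u = fresh3 x y z"
  have u: "x \<noteq> u" "y \<noteq> u" "z \<noteq> u" by (simp_all only: u_def fresh3_neq not_False_eq_True)
  define \<chi> where "\<chi> = And (residue_fm p (+) x y u) (inst3 \<sigma> x y u)"
  let ?\<psi> = "Exi u (And \<chi> (Less (Var u) (Var z)))"
  have \<chi>: "\<chi> \<in> Lp p"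
    using residue_fm_Lp inst3_Lp[OF approx_sumD(1)[OF assms(4)]] by (simp add: \<chi>_def Lp_def)
  then have \<psi>: "?\<psi> \<in> Lp p" "And \<chi> (Less (Var u) (Var z)) \<in> Lp p" "Less (Var u) (Var z) \<in> Lp p"
    by (simp_all add: Lp_def)
  have "sat p e ?\<psi>" if "e x + e y < e z" for e
  proof -
    \<comment> \<open>The true sum witnesses the existential quantifier. Since \<open>u\<close>
      differs from \<open>x\<close> and \<open>y\<close>, the update leaves the summands alone;
      since it differs from \<open>z\<close>, the bound \<open>e z\<close> is unchanged too.\<close>
    have "sat p (e(u := e x + e y)) \<chi>"
      unfolding \<chi>_def by (intro sat_coarse_sum assms) (simp add: u)
    with that u(3) show ?thesis by auto
  qed
  moreover have "coarse p \<sigma> \<pi> (Less (Plus (Var x) (Var y)) (Var z)) = lclass p ?\<psi>"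
    using \<chi> \<psi> by (simp add: coarse_sum_eq approx_sumD(1)[OF assms(4)] land_lclass lexi_lclass
        Let_def flip: u_def \<chi>_def)
  ultimately show ?case using \<psi>(1) by (intro bexI[of _ ?\<psi>]) simp_all
next
  case (6 x y z)
  let ?\<psi> = "And (residue_fm p (*) x y z) (inst3 \<pi> x y z)"
  have "?\<psi> \<in> Lp p"
    using residue_fm_Lp inst3_Lp[OF approx_prodD(1)[OF assms(5)]] by (simp add: Lp_def)
  then show ?case
    using sat_coarse_prod[OF assms(3,5)]
    by (intro bexI[of _ ?\<psi>]) (simp_all add: coarse_prod_eq approx_prodD(1)[OF assms(5)])
next
  case (7 x y z)
  define u where "u = fresh3 x y z"
  have u: "x \<noteq> u" "y \<noteq> u" "z \<noteq> u" by (simp_all only: u_def fresh3_neq not_False_eq_True)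
  define \<chi> where "\<chi> = And (residue_fm p (*) x y u) (inst3 \<pi> x y u)"
  let ?\<psi> = "Exi u (And \<chi> (Less (Var u) (Var z)))"
  have \<chi>: "\<chi> \<in> Lp p"
    using residue_fm_Lp inst3_Lp[OF approx_prodD(1)[OF assms(5)]] by (simp add: \<chi>_def Lp_def)
  then have \<psi>: "?\<psi> \<in> Lp p" "And \<chi> (Less (Var u) (Var z)) \<in> Lp p" "Less (Var u) (Var z) \<in> Lp p"
    by (simp_all add: Lp_def)
  have "sat p e ?\<psi>" if "e x * e y < e z" for e
  proof -
    \<comment> \<open>The true product is the witness.\<close>
    have "sat p (e(u := e x * e y)) \<chi>"
      unfolding \<chi>_def by (intro sat_coarse_prod assms) (simp add: u)
    with that u(3) show ?thesis by auto
  qed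
  moreover have "coarse p \<sigma> \<pi> (Less (Times (Var x) (Var y)) (Var z)) = lclass p ?\<psi>"
    using \<chi> \<psi> by (simp add: coarse_prod_eq approx_prodD(1)[OF assms(5)] land_lclass lexi_lclass
        Let_def flip: u_def \<chi>_def)
  ultimately show ?case using \<psi>(1) by (intro bexI[of _ ?\<psi>]) simp_all
next
  case (8 \<phi>\<^sub>1 \<phi>\<^sub>2)
  then obtain \<psi>\<^sub>1 \<psi>\<^sub>2 where "\<psi>\<^sub>1 \<in> Lp p" "\<psi>\<^sub>2 \<in> Lp p"
    "coarse p \<sigma> \<pi> \<phi>\<^sub>1 = lclass p \<psi>\<^sub>1" "coarse p \<sigma> \<pi> \<phi>\<^sub>2 = lclass p \<psi>\<^sub>2"
    "\<forall>e. sat p e \<phi>\<^sub>1 \<longrightarrow> sat p e \<psi>\<^sub>1" "\<forall>e. sat p e \<phi>\<^sub>2 \<longrightarrow> sat p e \<psi>\<^sub>2" by auto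
  then show ?case by (intro bexI[of _ "Or \<psi>\<^sub>1 \<psi>\<^sub>2"]) (auto simp: lor_lclass, simp add: Lp_def)
next
  case (9 \<phi>\<^sub>1 \<phi>\<^sub>2)
  then obtain \<psi>\<^sub>1 \<psi>\<^sub>2 where "\<psi>\<^sub>1 \<in> Lp p" "\<psi>\<^sub>2 \<in> Lp p"
    "coarse p \<sigma> \<pi> \<phi>\<^sub>1 = lclass p \<psi>\<^sub>1" "coarse p \<sigma> \<pi> \<phi>\<^sub>2 = lclass p \<psi>\<^sub>2"
    "\<forall>e. sat p e \<phi>\<^sub>1 \<longrightarrow> sat p e \<psi>\<^sub>1" "\<forall>e. sat p e \<phi>\<^sub>2 \<longrightarrow> sat p e \<psi>\<^sub>2" by auto
  then show ?case by (intro bexI[of _ "And \<psi>\<^sub>1 \<psi>\<^sub>2"]) (auto simp: land_lclass, simp add: Lp_def)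
next
  case (10 \<phi>)
  \<comment> \<open>Negation would reverse the inclusion; this case is excluded by
    positivity.\<close>
  then show ?case by simp
next
  case (11 \<phi> x)
  then obtain \<psi> where "\<psi> \<in> Lp p" "coarse p \<sigma> \<pi> \<phi> = lclass p \<psi>"
    "\<forall>e. sat p e \<phi> \<longrightarrow> sat p e \<psi>" by auto
  then show ?case by (intro bexI[of _ "Exi x \<psi>"]) (auto simp: lexi_lclass, simp add: Lp_def)
next
  case (12 \<phi> x)
  then obtain \<psi> where "\<psi> \<in> Lp p" "coarse p \<sigma> \<pi> \<phi> = lclass p \<psi>"
    "\<forall>e. sat p e \<phi> \<longrightarrow> sat p e \<psi>" by auto
  then show ?case by (intro bexI[of _ "Uni x \<psi>"]) (auto simp: luni_lclass, simp add: Lp_def)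
qed

theorem theorem3p2:
  fixes p :: nat and \<sigma> \<pi> \<phi> :: fm and T :: "fm \<Rightarrow> fm"
  assumes "p \<ge> 2"
    and "approx_sum p \<sigma>"
    and "approx_prod p \<pi>"
    and "translation p T"
    and "\<phi> \<in> Lp p"
    and "positive \<phi>"
  shows "lle p (lclass p \<phi>) (coarse_interp p \<sigma> \<pi> T \<phi>)"
proof -
  have T: "basic p (T \<phi>)" "positive (T \<phi>)" "Iff \<phi> (T \<phi>) \<in> Z p"
    using assms(4-6) by (auto simp: translation_def)
  from assms(1) have "p > 0" by simp
  from coarse_basic_weaker[OF T(1,2) this assms(2,3)]
  obtain \<psi> where \<psi>: "\<psi> \<in> Lp p" "coarse p \<sigma> \<pi> (T \<phi>) = lclass p \<psi>"
    "\<forall>e. sat p e (T \<phi>) \<longrightarrow> sat p e \<psi>" by auto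
  \<comment> \<open>The translation is exact over the integers, so information is lost only in
    passing from \<open>T \<phi>\<close> to \<open>\<psi>\<close>.\<close>
  have "Imp \<phi> \<psi> \<in> Z p"
    using T(3) \<psi>(1,3) by (auto simp: Z_def Lp_def)
  with \<psi>(1,2) assms(5) show ?thesis by (simp add: coarse_interp_def lle_lclass)
qed

end
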